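(* If the perturbation $g:S^2\to\mathbb{R}$ is a sum of even-degree spherical harmonics, then $g(-u)=g(u)$ for all $u\in S^2$, the body $B_\varepsilon$ with radial boundary $r(u)=1+\varepsilon g(u)$ is centrally symmetric, and its equilibria occur in antipodal pairs; consequently the numbers $S$ and $U$ of its stable and unstable equilibria are even, and $B_\varepsilon$ cannot be mono-monostatic. Mono-monostaticity of such a perturbed sphere therefore requires odd-degree content in $g$.
   Context: A spherical harmonic of degree $\ell$ is the restriction to the unit sphere $S^2\subset\mathbb{R}^3$ of a homogeneous harmonic polynomial of degree $\ell$. A function $g$ on $S^2$ has odd-degree content if its spherical-harmonic expansion has a nonzero component of some odd degree. For a smooth function $g:S^2\to\mathbb{R}$ (the perturbation), $B_\varepsilon$ is the body with radial boundary $r(u)=1+\varepsilon g(u)$, $u\in S^2$, taken homogeneous (uniform mass density) and, for $\varepsilon$ small enough, convex; $\mathbf{c}$ is its centroid. The static equilibria of $B_\varepsilon$ are the critical points $u\in S^2$ of $\rho(u)=|r(u)u-\mathbf{c}|^2$; local minima of $\rho$ are stable equilibria, local maxima are unstable equilibria, and saddles are of saddle type. $S$ and $U$ are the numbers of stable and unstable equilibria. The body is mono-monostatic if $S=U=1$. *)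

theory Defs
  imports "HOL-Analysis.Analysis"
begin

abbreviation S2 :: "(real^3) set"
  where "S2 \<equiv> sphere 0 1"

section \<open>Smooth functions on the unit sphere\<close>

definition partial_deriv :: "real^3 \<Rightarrow> (real^3 \<Rightarrow> real) \<Rightarrow> real^3 \<Rightarrow> real"
  where "partial_deriv b f x = frechet_derivative f (at x) b"

fun Ck_on :: "nat \<Rightarrow> (real^3 \<Rightarrow> real) \<Rightarrow> (real^3) set \<Rightarrow> bool"
  where
    "Ck_on 0 f U \<longleftrightarrow> continuous_on U f"
  | "Ck_on (Suc k) f U \<longleftrightarrow>
       f differentiable_on U \<and> (\<forall>b\<in>Basis. Ck_on k (partial_deriv b f) U)"

text \<open>
  Functions on the sphere are represented by total functions on the ambient space; only their
  values on the sphere ever matter. Smoothness means local extendability to a smooth function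
  on an open subset of the ambient space.
\<close>

definition smooth_on_S2 :: "(real^3 \<Rightarrow> real) \<Rightarrow> bool"
  where "smooth_on_S2 g \<longleftrightarrow>
    (\<forall>p\<in>S2. \<exists>U f. open U \<and> p \<in> U \<and> (\<forall>k. Ck_on k f U) \<and> (\<forall>u\<in>U \<inter> S2. f u = g u))"

section \<open>Spherical harmonics\<close>

definition homogeneous_polynomial :: "nat \<Rightarrow> (real^3 \<Rightarrow> real) \<Rightarrow> bool"
  where "homogeneous_polynomial l p \<longleftrightarrow>
    (\<exists>a :: nat \<Rightarrow> nat \<Rightarrow> real.
       p = (\<lambda>x. \<Sum>i\<le>l. \<Sum>j\<le>l - i. a i j * x$1 ^ i * x$2 ^ j * x$3 ^ (l - i - j)))"

definition laplacian :: "(real^3 \<Rightarrow> real) \<Rightarrow> real^3 \<Rightarrow> real"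
  where "laplacian p x = (\<Sum>b\<in>Basis. partial_deriv b (partial_deriv b p) x)"

definition spherical_harmonic :: "nat \<Rightarrow> (real^3 \<Rightarrow> real) \<Rightarrow> bool"
  where "spherical_harmonic l Y \<longleftrightarrow>
    (\<exists>p. homogeneous_polynomial l p \<and> (\<forall>x. laplacian p x = 0) \<and> (\<forall>u\<in>S2. Y u = p u))"

text \<open>
  The summands may have arbitrary even degrees, in any order and with repetitions. Pointwise
  convergence is the weakest requirement; finite sums (pad with the harmonic 0) and uniformly
  convergent series are included.
\<close>

definition sum_of_even_harmonics :: "(real^3 \<Rightarrow> real) \<Rightarrow> bool"
  where "sum_of_even_harmonics g \<longleftrightarrow>
    (\<exists>d Y. (\<forall>k::nat. even (d k) \<and> spherical_harmonic (d k) (Y k)) \<and>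
           (\<forall>u\<in>S2. (\<lambda>k. Y k u) sums g u))"

text \<open>
  Surface measure on the sphere, of total mass \<open>4 * pi\<close>: in polar coordinates
  \<open>x = t u\<close> Lebesgue measure is \<open>t^2 dt\<close> times surface measure, and \<open>t^2\<close> integrates
  to \<open>1/3\<close> over \<open>[0,1]\<close>. Note that \<open>sgn x\<close> is \<open>x\<close> divided by its norm.
\<close>

definition surface_measure :: "(real^3) measure"
  where "surface_measure =
    scale_measure 3
      (distr (restrict_space lborel (cball 0 1 - {0})) (restrict_space borel S2) sgn)"

text \<open>
  The degree-\<open>l\<close> component of the spherical-harmonic expansion of \<open>g\<close> is the orthogonal
  projection, with respect to the surface measure, of \<open>g\<close> onto the spherical harmonics
  of degree \<open>l\<close>.
\<close>

definition harmonic_component :: "(real^3 \<Rightarrow> real) \<Rightarrow> nat \<Rightarrow> (real^3 \<Rightarrow> real) \<Rightarrow> bool"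
  where "harmonic_component g l Y \<longleftrightarrow>
    spherical_harmonic l Y \<and>
    (\<forall>Z. spherical_harmonic l Z \<longrightarrow> (\<integral>u. (g u - Y u) * Z u \<partial>surface_measure) = 0)"

definition odd_degree_content :: "(real^3 \<Rightarrow> real) \<Rightarrow> bool"
  where "odd_degree_content g \<longleftrightarrow>
    (\<exists>l Y. odd l \<and> harmonic_component g l Y \<and> (\<exists>u\<in>S2. Y u \<noteq> 0))"

section \<open>The perturbed sphere and its equilibria\<close>

definition radial :: "(real^3 \<Rightarrow> real) \<Rightarrow> real \<Rightarrow> real^3 \<Rightarrow> real"
  where "radial g \<epsilon> u = 1 + \<epsilon> * g u"

definition body :: "(real^3 \<Rightarrow> real) \<Rightarrow> real \<Rightarrow> (real^3) set"
  where "body g \<epsilon> = {t *\<^sub>R u | t u. u \<in> S2 \<and> 0 \<le> t \<and> t \<le> radial g \<epsilon> u}"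

text \<open>The smallness condition on \<open>\<epsilon>\<close>: the radial function is positive and the body is convex.\<close>

definition admissible :: "(real^3 \<Rightarrow> real) \<Rightarrow> real \<Rightarrow> bool"
  where "admissible g \<epsilon> \<longleftrightarrow> (\<forall>u\<in>S2. 0 < radial g \<epsilon> u) \<and> convex (body g \<epsilon>)"

definition centroid :: "(real^3) set \<Rightarrow> real^3"
  where "centroid B = (1 / measure lborel B) *\<^sub>R set_lebesgue_integral lborel B (\<lambda>x. x)"

definition rho :: "(real^3 \<Rightarrow> real) \<Rightarrow> real \<Rightarrow> real^3 \<Rightarrow> real"
  where "rho g \<epsilon> u = (norm (radial g \<epsilon> u *\<^sub>R u - centroid (body g \<epsilon>)))\<^sup>2"

text \<open>
  A derivative within the sphere is determined only on the tangent space
  \<open>{v. u \<bullet> v = 0}\<close>, where it is the differential of the function on the sphere.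
\<close>

definition critical_point_S2 :: "(real^3 \<Rightarrow> real) \<Rightarrow> real^3 \<Rightarrow> bool"
  where "critical_point_S2 f u \<longleftrightarrow>
    u \<in> S2 \<and> (\<exists>D. (f has_derivative D) (at u within S2) \<and> (\<forall>v. u \<bullet> v = 0 \<longrightarrow> D v = 0))"

definition local_min_S2 :: "(real^3 \<Rightarrow> real) \<Rightarrow> real^3 \<Rightarrow> bool"
  where "local_min_S2 f u \<longleftrightarrow> u \<in> S2 \<and> (\<forall>\<^sub>F v in at u within S2. f u \<le> f v)"

definition local_max_S2 :: "(real^3 \<Rightarrow> real) \<Rightarrow> real^3 \<Rightarrow> bool"
  where "local_max_S2 f u \<longleftrightarrow> u \<in> S2 \<and> (\<forall>\<^sub>F v in at u within S2. f v \<le> f u)"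

definition equilibria :: "(real^3 \<Rightarrow> real) \<Rightarrow> real \<Rightarrow> (real^3) set"
  where "equilibria g \<epsilon> = {u. critical_point_S2 (rho g \<epsilon>) u}"

definition stable_equilibria :: "(real^3 \<Rightarrow> real) \<Rightarrow> real \<Rightarrow> (real^3) set"
  where "stable_equilibria g \<epsilon> = {u \<in> equilibria g \<epsilon>. local_min_S2 (rho g \<epsilon>) u}"

definition unstable_equilibria :: "(real^3 \<Rightarrow> real) \<Rightarrow> real \<Rightarrow> (real^3) set"
  where "unstable_equilibria g \<epsilon> = {u \<in> equilibria g \<epsilon>. local_max_S2 (rho g \<epsilon>) u}"

definition saddle_equilibria :: "(real^3 \<Rightarrow> real) \<Rightarrow> real \<Rightarrow> (real^3) set"
  where "saddle_equilibria g \<epsilon> =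
    equilibria g \<epsilon> - stable_equilibria g \<epsilon> - unstable_equilibria g \<epsilon>"

definition mono_monostatic :: "(real^3 \<Rightarrow> real) \<Rightarrow> real \<Rightarrow> bool"
  where "mono_monostatic g \<epsilon> \<longleftrightarrow>
    card (stable_equilibria g \<epsilon>) = 1 \<and> card (unstable_equilibria g \<epsilon>) = 1"

definition antipodal_pairs :: "(real^3) set \<Rightarrow> bool"
  where "antipodal_pairs A \<longleftrightarrow> (\<forall>u\<in>A. - u \<in> A \<and> - u \<noteq> u)"

end

theory Submission
  imports Defs
begin

text \<open>
  If the perturbation is even, the body is centrally symmetric. Its centroid is then the origin,
  so the squared distance \<open>rho\<close> is an even function on the sphere, and the antipodal map permutes
  the critical points, the local minima and the local maxima without fixed points
  (\<open>antipodal_pairs_equilibria\<close>). This settles everything about sums of even harmonics, because a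
  harmonic of even degree is even.

  The last claim needs the converse direction of the dictionary between degree and parity: a
  continuous \<open>g\<close> all of whose odd-degree components vanish is even
  (\<open>even_if_no_odd_degree_content\<close>). A component is known only through its defining orthogonality
  relations, so it has to be constructed first (\<open>harmonic_component_exists\<close>). Once it exists
  and vanishes, \<open>g\<close> is orthogonal to every harmonic of odd degree. Completeness of the spherical
  harmonics then enters only through zonal harmonics. For a pole \<open>v\<close>, the Legendre recursion writes
  a harmonic of degree \<open>n\<close> as a combination of the powers \<open>(u \<bullet> v) ^ (n - 2 * k)\<close> with leading
  coefficient 1 (\<open>spherical_harmonic_zonal\<close>), so by induction \<open>g\<close> is orthogonal to all odd powers of
  \<open>u \<bullet> v\<close>. Consequently \<open>h u = g u - g (- u)\<close> is orthogonal to all powers of \<open>u \<bullet> v\<close>: to the even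
  ones by parity. By the Weierstrass theorem on \<open>[-1, 1]\<close> it is orthogonal to every continuous
  function of \<open>u \<bullet> v\<close>, in particular to a bump concentrated near \<open>v\<close>, which is impossible
  if \<open>h v > 0\<close>. As \<open>v\<close> is arbitrary and \<open>h\<close> is odd, \<open>h\<close> vanishes on the sphere.
\<close>

section \<open>Homogeneous polynomials\<close>

text \<open>
  The defining double sum only ranges over exponent triples of total degree \<open>l\<close>, so products are
  awkward to reindex directly; it is easier to multiply monomial by monomial and to add up again.
\<close>

lemma homogeneous_polynomial_monomial:
  "homogeneous_polynomial (i + j + k) (\<lambda>x. c * x$1 ^ i * x$2 ^ j * x$3 ^ k)"
proof -
  define l where "l = i + j + k"
  define a where "a i' j' = (if i' = i then if j' = j then c else 0 else 0)" for i' j'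
  have "(\<Sum>i'\<le>l. \<Sum>j'\<le>l - i'. a i' j' * x$1 ^ i' * x$2 ^ j' * x$3 ^ (l - i' - j'))
      = c * x$1 ^ i * x$2 ^ j * x$3 ^ k" for x :: "real^3"
  proof -
    have inner: "(\<Sum>j'\<le>l - i'. a i' j' * x$1 ^ i' * x$2 ^ j' * x$3 ^ (l - i' - j'))
        = (if i' = i then c * x$1 ^ i * x$2 ^ j * x$3 ^ k else 0)" for i'
    proof (cases "i' = i")
      case True
      have "(\<Sum>j'\<le>l - i'. a i' j' * x$1 ^ i' * x$2 ^ j' * x$3 ^ (l - i' - j'))
          = (\<Sum>j'\<le>l - i. if j' = j then c * x$1 ^ i * x$2 ^ j * x$3 ^ (l - i - j) else 0)"
        by (intro sum.cong) (auto simp: a_def True)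
      then show ?thesis
        by (simp add: True l_def)
    qed (simp add: a_def)
    show ?thesis
      unfolding inner by (simp add: l_def)
  qed
  then have "(\<lambda>x. c * x$1 ^ i * x$2 ^ j * x$3 ^ k) =
      (\<lambda>x::real^3. \<Sum>i\<le>l. \<Sum>j\<le>l - i. a i j * x$1 ^ i * x$2 ^ j * x$3 ^ (l - i - j))"
    by (simp add: fun_eq_iff)
  then show ?thesis
    unfolding homogeneous_polynomial_def l_def by blast
qed

lemma homogeneous_polynomial_zero: "homogeneous_polynomial l (\<lambda>x. 0)"
  using homogeneous_polynomial_monomial[of l 0 0 0] by simp

lemma homogeneous_polynomial_lincomb:
  assumes "homogeneous_polynomial l p" "homogeneous_polynomial l q"
  shows "homogeneous_polynomial l (\<lambda>x. p x + d * q x)"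
proof -
  obtain a b where
    "p = (\<lambda>x. \<Sum>i\<le>l. \<Sum>j\<le>l - i. a i j * x$1 ^ i * x$2 ^ j * x$3 ^ (l - i - j))"
    "q = (\<lambda>x. \<Sum>i\<le>l. \<Sum>j\<le>l - i. b i j * x$1 ^ i * x$2 ^ j * x$3 ^ (l - i - j))"
    using assms unfolding homogeneous_polynomial_def by blast
  then have "(\<lambda>x. p x + d * q x) =
      (\<lambda>x. \<Sum>i\<le>l. \<Sum>j\<le>l - i. (a i j + d * b i j) * x$1 ^ i * x$2 ^ j * x$3 ^ (l - i - j))"
    by (simp add: fun_eq_iff sum_distrib_left sum.distrib algebra_simps)
  then show ?thesis
    unfolding homogeneous_polynomial_def by (intro exI[of _ "\<lambda>i j. a i j + d * b i j"])
qed

lemma homogeneous_polynomial_cmult: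
  "homogeneous_polynomial l p \<Longrightarrow> homogeneous_polynomial l (\<lambda>x. d * p x)"
  using homogeneous_polynomial_lincomb[OF homogeneous_polynomial_zero] by simp

lemma homogeneous_polynomial_sum:
  assumes "finite I" "\<And>i. i \<in> I \<Longrightarrow> homogeneous_polynomial l (p i)"
  shows "homogeneous_polynomial l (\<lambda>x. \<Sum>i\<in>I. p i x)"
  using assms
proof (induction I rule: finite_induct)
  case empty
  then show ?case by (simp add: homogeneous_polynomial_zero)
next
  case (insert i I)
  then show ?case
    using homogeneous_polynomial_lincomb[of l "p i" _ 1] by simp
qed

lemma homogeneous_polynomial_mult_coordinate:
  assumes "homogeneous_polynomial l p"
  shows "homogeneous_polynomial (Suc l) (\<lambda>x. x$s * p x)"
proof -
  obtain a where p:
    "p = (\<lambda>x. \<Sum>i\<le>l. \<Sum>j\<le>l - i. a i j * x$1 ^ i * x$2 ^ j * x$3 ^ (l - i - j))"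
    using assms unfolding homogeneous_polynomial_def by blast
  have "homogeneous_polynomial (Suc l)
      (\<lambda>x. \<Sum>i\<le>l. \<Sum>j\<le>l - i. x$s * (a i j * x$1 ^ i * x$2 ^ j * x$3 ^ (l - i - j)))"
  proof (intro homogeneous_polynomial_sum)
    fix i j assume "i \<in> {..l}" "j \<in> {..l - i}"
    then have l: "i + j + (l - i - j) = l"
      by auto
    note * = homogeneous_polynomial_monomial[of "Suc i" j "l - i - j" "a i j"]
      homogeneous_polynomial_monomial[of i "Suc j" "l - i - j" "a i j"]
      homogeneous_polynomial_monomial[of i j "Suc (l - i - j)" "a i j"]
    show "homogeneous_polynomial (Suc l)
        (\<lambda>x. x$s * (a i j * x$1 ^ i * x$2 ^ j * x$3 ^ (l - i - j)))"
      using exhaust_3[of s] * unfolding add_Suc add_Suc_right l by (elim disjE) (simp_all add: mult_ac)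
  qed auto
  then show ?thesis
    by (simp add: p sum_distrib_left)
qed

lemma homogeneous_polynomial_mult_inner:
  assumes "homogeneous_polynomial l p"
  shows "homogeneous_polynomial (Suc l) (\<lambda>x. (x \<bullet> v) * p x)"
proof -
  have "homogeneous_polynomial (Suc l) (\<lambda>x. \<Sum>s\<in>UNIV. v$s * (x$s * p x))"
    by (intro homogeneous_polynomial_sum homogeneous_polynomial_cmult
        homogeneous_polynomial_mult_coordinate assms) auto
  then show ?thesis
    by (simp add: inner_vec_def sum_distrib_right sum_distrib_left mult_ac)
qed

lemma homogeneous_polynomial_mult_norm_square:
  assumes "homogeneous_polynomial l p"
  shows "homogeneous_polynomial (l + 2) (\<lambda>x. (x \<bullet> x) * p x)"
proof -
  have "homogeneous_polynomial (Suc (Suc l)) (\<lambda>x. \<Sum>s\<in>UNIV. x$s * (x$s * p x))"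
    by (intro homogeneous_polynomial_sum homogeneous_polynomial_mult_coordinate assms) auto
  then show ?thesis
    by (simp add: inner_vec_def sum_distrib_right sum_distrib_left mult_ac)
qed

lemma homogeneous_polynomial_inner_power:
  "homogeneous_polynomial (m + 2 * k) (\<lambda>x. (x \<bullet> v) ^ m * (x \<bullet> x) ^ k)"
proof (induction k)
  case 0
  show ?case
  proof (induction m)
    case 0
    show ?case using homogeneous_polynomial_monomial[of 0 0 0 1] by simp
  next
    case (Suc m)
    then show ?case
      using homogeneous_polynomial_mult_inner[OF Suc.IH, of v] by simp
  qed
next
  case (Suc k)
  then show ?case
    using homogeneous_polynomial_mult_norm_square[OF Suc.IH] by (simp add: mult.left_commute)
qed

lemma homogeneous_polynomial_minus:
  assumes "homogeneous_polynomial l p"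
  shows "p (- x) = (-1) ^ l * p x"
proof -
  obtain a where p:
    "p = (\<lambda>x. \<Sum>i\<le>l. \<Sum>j\<le>l - i. a i j * x$1 ^ i * x$2 ^ j * x$3 ^ (l - i - j))"
    using assms unfolding homogeneous_polynomial_def by blast
  have "a i j * (- x)$1 ^ i * (- x)$2 ^ j * (- x)$3 ^ (l - i - j)
      = (-1) ^ l * (a i j * x$1 ^ i * x$2 ^ j * x$3 ^ (l - i - j))"
    if "i \<in> {..l}" "j \<in> {..l - i}" for i j
  proof -
    have "l = i + j + (l - i - j)"
      using that by auto
    then have "(-1) ^ l = (-1) ^ i * (-1) ^ j * ((-1) ^ (l - i - j) :: real)"
      by (metis power_add)
    then show ?thesis
      by (simp add: power_minus[of "x$1"] power_minus[of "x$2"] power_minus[of "x$3"] mult_ac)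
  qed
  then show ?thesis
    unfolding p sum_distrib_left by (intro sum.cong refl) blast
qed

lemma spherical_harmonic_minus:
  assumes "spherical_harmonic l Y" "u \<in> S2"
  shows "Y (- u) = (-1) ^ l * Y u"
  using assms homogeneous_polynomial_minus unfolding spherical_harmonic_def
  by (metis dist_0_norm mem_sphere norm_minus_cancel)

lemma real_polynomial_function_homogeneous:
  assumes "homogeneous_polynomial l p"
  shows "real_polynomial_function p"
proof -
  obtain a where p:
    "p = (\<lambda>x. \<Sum>i\<le>l. \<Sum>j\<le>l - i. a i j * x$1 ^ i * x$2 ^ j * x$3 ^ (l - i - j))"
    using assms unfolding homogeneous_polynomial_def by blast
  show ?thesis
    unfolding p
    by (intro real_polynomial_function_sum real_polynomial_function.intros(4)
        real_polynomial_function.intros(2) real_polynomial_function_power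
        real_polynomial_function.intros(1) bounded_linear_vec_nth) auto
qed

lemma spherical_harmonic_continuous:
  assumes "spherical_harmonic l Y"
  shows "continuous_on S2 Y"
proof -
  obtain p where p: "homogeneous_polynomial l p" "\<forall>u\<in>S2. Y u = p u"
    using assms unfolding spherical_harmonic_def by blast
  have "continuous_on S2 p"
    using real_polynomial_function_homogeneous[OF p(1)]
    by (simp add: real_polynomial_function_eq continuous_on_polymonial_function)
  then show ?thesis
    by (rule continuous_on_eq) (use p in auto)
qed

section \<open>The Laplacian and zonal harmonics\<close>

lemma partial_deriv_eqI:
  assumes "\<And>x. (f has_derivative D x) (at x)"
  shows "partial_deriv b f = (\<lambda>x. D x b)"
  unfolding partial_deriv_def using frechet_derivative_at[OF assms] by metis

lemma has_derivative_partial_deriv: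
  assumes "real_polynomial_function f"
  shows "(f has_derivative (\<lambda>b. partial_deriv b f x)) (at x)"
  using differentiable_at_real_polynomial_function[OF assms, of x UNIV]
  unfolding partial_deriv_def by (simp add: frechet_derivative_works[symmetric])

lemma real_polynomial_function_partial_deriv:
  assumes "real_polynomial_function f"
  shows "real_polynomial_function (partial_deriv b f)"
  using assms
proof (induction f rule: real_polynomial_function.induct)
  case (linear f)
  then have "partial_deriv b f = (\<lambda>x. f b)"
    by (intro partial_deriv_eqI bounded_linear_imp_has_derivative)
  then show ?case by auto
next
  case (const c)
  have "partial_deriv b (\<lambda>x. c) = (\<lambda>x. 0)"
    by (intro partial_deriv_eqI has_derivative_const)
  then show ?case by auto
next
  case (add f g)
  have "partial_deriv b (\<lambda>x. f x + g x) = (\<lambda>x. partial_deriv b f x + partial_deriv b g x)"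
    by (intro partial_deriv_eqI has_derivative_add has_derivative_partial_deriv add.hyps)
  then show ?case using add.IH by auto
next
  case (mult f g)
  have "partial_deriv b (\<lambda>x. f x * g x)
      = (\<lambda>x. f x * partial_deriv b g x + partial_deriv b f x * g x)"
    by (intro partial_deriv_eqI has_derivative_mult has_derivative_partial_deriv mult.hyps)
  then show ?case using mult by auto
qed

lemma partial_deriv_lincomb:
  assumes "real_polynomial_function p" "real_polynomial_function q"
  shows "partial_deriv b (\<lambda>x. p x + d * q x)
      = (\<lambda>x. partial_deriv b p x + d * partial_deriv b q x)"
  by (intro partial_deriv_eqI has_derivative_add has_derivative_mult_right
      has_derivative_partial_deriv assms)

lemma laplacian_lincomb:
  assumes "real_polynomial_function p" "real_polynomial_function q"
  shows "laplacian (\<lambda>x. p x + d * q x) x = laplacian p x + d * laplacian q x"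
  unfolding laplacian_def partial_deriv_lincomb[OF assms]
    partial_deriv_lincomb[OF assms[THEN real_polynomial_function_partial_deriv]]
  by (simp add: sum.distrib sum_distrib_left)

lemma laplacian_zero: "laplacian (\<lambda>x. 0) x = 0"
  using laplacian_lincomb[of "\<lambda>x. 0" "\<lambda>x. 0" "-1" x] by auto

lemma laplacian_sum:
  assumes "finite I" "\<And>i. i \<in> I \<Longrightarrow> real_polynomial_function (p i)"
  shows "laplacian (\<lambda>x. \<Sum>i\<in>I. c i * p i x) x = (\<Sum>i\<in>I. c i * laplacian (p i) x)"
  using assms
proof (induction I rule: finite_induct)
  case empty
  then show ?case by (simp add: laplacian_zero)
next
  case (insert i I)
  have "real_polynomial_function (\<lambda>x. \<Sum>i\<in>I. c i * p i x)"
    using insert by (intro real_polynomial_function_sum real_polynomial_function.intros(4)) auto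
  then show ?case
    using insert laplacian_lincomb[of "\<lambda>x. \<Sum>i\<in>I. c i * p i x" "p i" "c i" x]
    by (simp add: add.commute)
qed

text \<open>
  With \<open>s = x \<bullet> v\<close> and \<open>q = x \<bullet> x\<close>, the gradients are \<open>v\<close> and \<open>2 x\<close>, and \<open>v \<bullet> v = 1\<close>, \<open>v \<bullet> x = s\<close>,
  \<open>x \<bullet> x = q\<close>. So the Laplacian stays within the span of such products, and the two terms have the
  exponents of \<open>(m - 2, k)\<close> and \<open>(m, k - 1)\<close>, which makes a two-term recursion for harmonic
  combinations possible.
\<close>

lemma laplacian_inner_power:
  fixes v :: "real^3"
  assumes "v \<bullet> v = 1"
  shows "laplacian (\<lambda>x. (x \<bullet> v) ^ m * (x \<bullet> x) ^ k) x
    = real (m * (m - 1)) * (x \<bullet> v) ^ (m - 2) * (x \<bullet> x) ^ k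
      + real (2 * k * (2 * m + 2 * k + 1)) * (x \<bullet> v) ^ m * (x \<bullet> x) ^ (k - 1)"
proof -
  define D where "D b x = real m * (x \<bullet> v) ^ (m - 1) * (b \<bullet> v) * (x \<bullet> x) ^ k
    + (x \<bullet> v) ^ m * (real k * (x \<bullet> x) ^ (k - 1) * (2 * (x \<bullet> b)))" for b x :: "real^3"
  have D: "partial_deriv b (\<lambda>x. (x \<bullet> v) ^ m * (x \<bullet> x) ^ k) = (\<lambda>x. D b x)" for b
    unfolding D_def
    by (rule partial_deriv_eqI) (auto intro!: derivative_eq_intros simp: inner_commute algebra_simps)
  define E where "E b x =
      real m * real (m - 1) * (x \<bullet> v) ^ (m - 1 - 1) * (x \<bullet> x) ^ k * (b \<bullet> v) ^ 2
    + 4 * real m * real k * (x \<bullet> v) ^ (m - 1) * (x \<bullet> x) ^ (k - 1) * ((b \<bullet> v) * (x \<bullet> b))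
    + 4 * real k * real (k - 1) * (x \<bullet> v) ^ m * (x \<bullet> x) ^ (k - 1 - 1) * (x \<bullet> b) ^ 2
    + 2 * real k * (x \<bullet> v) ^ m * (x \<bullet> x) ^ (k - 1) * (b \<bullet> b)" for b x :: "real^3"
  have E: "partial_deriv b (D b) = E b" for b
  proof -
    have "(D b has_derivative (\<lambda>h.
        real m * (real (m - 1) * (h \<bullet> v) * (x \<bullet> v) ^ (m - 1 - 1)) * (b \<bullet> v) * (x \<bullet> x) ^ k
        + real m * (x \<bullet> v) ^ (m - 1) * (b \<bullet> v) * (real k * (2 * (x \<bullet> h)) * (x \<bullet> x) ^ (k - 1))
        + real m * (h \<bullet> v) * (x \<bullet> v) ^ (m - 1) * (real k * (x \<bullet> x) ^ (k - 1) * (2 * (x \<bullet> b)))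
        + (x \<bullet> v) ^ m * (real k * (real (k - 1) * (2 * (x \<bullet> h)) * (x \<bullet> x) ^ (k - 1 - 1)) * (2 * (x \<bullet> b)))
        + (x \<bullet> v) ^ m * (real k * (x \<bullet> x) ^ (k - 1) * (2 * (h \<bullet> b))))) (at x)" for x
      unfolding D_def[abs_def]
      by (rule derivative_eq_intros refl)+ (simp add: fun_eq_iff inner_commute algebra_simps)
    from partial_deriv_eqI[OF this] show ?thesis
      by (simp add: E_def fun_eq_iff power2_eq_square algebra_simps)
  qed
  have Basis: "(\<Sum>b\<in>Basis. (b \<bullet> v)\<^sup>2) = 1" "(\<Sum>b\<in>Basis. (b \<bullet> v) * (x \<bullet> b)) = x \<bullet> v"
    "(\<Sum>b\<in>Basis. (x \<bullet> b)\<^sup>2) = x \<bullet> x" "(\<Sum>b\<in>(Basis::(real^3) set). b \<bullet> b) = 3"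
    using assms euclidean_inner[of v v] euclidean_inner[of x v] euclidean_inner[of x x]
    by (auto simp: power2_eq_square inner_commute mult_ac)
  have "laplacian (\<lambda>x. (x \<bullet> v) ^ m * (x \<bullet> x) ^ k) x = (\<Sum>b\<in>Basis. E b x)"
    unfolding laplacian_def D E ..
  also have "\<dots> = real m * real (m - 1) * (x \<bullet> v) ^ (m - 1 - 1) * (x \<bullet> x) ^ k
    + 4 * real m * real k * (x \<bullet> v) ^ (m - 1) * (x \<bullet> x) ^ (k - 1) * (x \<bullet> v)
    + 4 * real k * real (k - 1) * (x \<bullet> v) ^ m * (x \<bullet> x) ^ (k - 1 - 1) * (x \<bullet> x)
    + 2 * real k * (x \<bullet> v) ^ m * (x \<bullet> x) ^ (k - 1) * 3"
    unfolding E_def sum.distrib by (simp only: sum_distrib_left[symmetric] Basis mult_1_right)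
  also have "\<dots> = real (m * (m - 1)) * (x \<bullet> v) ^ (m - 2) * (x \<bullet> x) ^ k
      + real (2 * k * (2 * m + 2 * k + 1)) * (x \<bullet> v) ^ m * (x \<bullet> x) ^ (k - 1)"
  proof -
    have s: "real m * ((x \<bullet> v) ^ (m - 1) * (x \<bullet> v)) = real m * (x \<bullet> v) ^ m"
      by (cases m) auto
    have q: "real k * (real (k - 1) * ((x \<bullet> x) ^ (k - 1 - 1) * (x \<bullet> x)))
        = real k * ((real k - 1) * (x \<bullet> x) ^ (k - 1))"
      by (cases k; cases "k - 1") auto
    have "4 * real m * real k * (x \<bullet> v) ^ (m - 1) * (x \<bullet> x) ^ (k - 1) * (x \<bullet> v)
        = 4 * real k * (x \<bullet> x) ^ (k - 1) * (real m * (x \<bullet> v) ^ m)"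
      by (subst s[symmetric]) (simp only: mult_ac)
    moreover have "4 * real k * real (k - 1) * (x \<bullet> v) ^ m * (x \<bullet> x) ^ (k - 1 - 1) * (x \<bullet> x)
        = 4 * (x \<bullet> v) ^ m * (real k * ((real k - 1) * (x \<bullet> x) ^ (k - 1)))"
      by (subst q[symmetric]) (simp only: mult_ac)
    moreover have "m - 1 - 1 = m - 2"
      by simp
    moreover have "M * M' * S * Q + 4 * K * Q' * (M * S') + 4 * S' * (K * ((K - 1) * Q')) + 2 * K * S' * Q' * 3
        = M * M' * S * Q + 2 * K * (2 * M + 2 * K + 1) * S' * Q'" for M M' S Q K Q' S' :: real
      by algebra
    ultimately show ?thesis
      by (simp only: of_nat_mult of_nat_add of_nat_numeral of_nat_1)
  qed
  finally show ?thesis .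
qed

text \<open>
  The coefficients, up to a common factor, of the Legendre polynomial of degree \<open>n\<close>, listed from the
  leading power downwards and normalised to have leading coefficient 1.
\<close>

fun zonal_coeff :: "nat \<Rightarrow> nat \<Rightarrow> real" where
  "zonal_coeff n 0 = 1"
| "zonal_coeff n (Suc k) =
    - zonal_coeff n k * real ((n - 2 * k) * (n - 2 * k - 1)) / real (2 * Suc k * (2 * n - 2 * k - 1))"

text \<open>
  The homogeneous extension has the summands \<open>(x \<bullet> v) ^ (n - 2 * k) * (x \<bullet> x) ^ k\<close>, in which the second
  factor is invisible on the sphere. Its Laplacian telescopes: the recursion for the coefficients
  makes the second term of each summand cancel the first term of the preceding one.
\<close>

lemma spherical_harmonic_zonal:
  assumes v: "v \<in> S2"
  shows "spherical_harmonic n (\<lambda>x. \<Sum>k\<le>n div 2. zonal_coeff n k * (x \<bullet> v) ^ (n - 2 * k))"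
proof -
  define N where "N = n div 2"
  define q where "q k x = (x \<bullet> v) ^ (n - 2 * k) * (x \<bullet> x) ^ k" for k and x :: "real^3"
  have q_hom: "homogeneous_polynomial n (q k)" if "k \<le> N" for k
    using homogeneous_polynomial_inner_power[of "n - 2 * k" k v] that
    unfolding q_def N_def by simp
  have vv: "v \<bullet> v = 1"
    using v by (simp add: dot_square_norm)
  have "laplacian (\<lambda>x. \<Sum>k\<le>N. zonal_coeff n k * q k x) x = 0" for x
  proof -
    \<comment> \<open>\<open>A k\<close> and \<open>B k\<close> are the two terms in the Laplacian of the \<open>k\<close>-th summand.\<close>
    define A where "A k = zonal_coeff n k * real ((n - 2 * k) * (n - 2 * k - 1))
      * (x \<bullet> v) ^ (n - 2 * k - 2) * (x \<bullet> x) ^ k" for k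
    define B where "B k = zonal_coeff n k * real (2 * k * (2 * (n - 2 * k) + 2 * k + 1))
      * (x \<bullet> v) ^ (n - 2 * k) * (x \<bullet> x) ^ (k - 1)" for k
    have lap: "laplacian (\<lambda>x. \<Sum>k\<le>N. zonal_coeff n k * q k x) x = (\<Sum>k\<le>N. A k + B k)"
    proof -
      have "laplacian (\<lambda>x. \<Sum>k\<le>N. zonal_coeff n k * q k x) x
          = (\<Sum>k\<le>N. zonal_coeff n k * laplacian (q k) x)"
        by (intro laplacian_sum real_polynomial_function_homogeneous[OF q_hom]) auto
      then show ?thesis
        unfolding q_def laplacian_inner_power[OF vv] A_def B_def
        by (simp add: distrib_left mult_ac)
    qed
    have B_Suc: "B (Suc k) = - A k" if "Suc k \<le> N" for k
    proof -
      have k: "2 * Suc k \<le> n"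
        using that by (simp add: N_def)
      then have "2 * (n - 2 * Suc k) + 2 * Suc k + 1 = 2 * n - 2 * k - 1"
        by simp
      moreover have "real (2 * Suc k * (2 * n - 2 * k - 1)) \<noteq> 0"
        using k by (simp del: of_nat_mult)
      ultimately have "zonal_coeff n (Suc k) * real (2 * Suc k * (2 * (n - 2 * Suc k) + 2 * Suc k + 1))
          = - zonal_coeff n k * real ((n - 2 * k) * (n - 2 * k - 1))"
        by (simp del: of_nat_mult)
      then show ?thesis
        unfolding A_def B_def by (simp add: diff_diff_left)
    qed
    have telescope: "(\<Sum>k\<le>M. A k + B k) = A M" if "M \<le> N" for M
      using that
    proof (induction M)
      case 0
      show ?case by (simp add: B_def)
    next
      case (Suc M)
      then show ?case using B_Suc[of M] by simp
    qed
    \<comment> \<open>The remaining term contains \<open>m * (m - 1)\<close> for the lowest exponent \<open>m\<close>, which is 0 or 1.\<close>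
    have "n - 2 * N = 0 \<or> n - 2 * N = 1"
      unfolding N_def by presburger
    then have "A N = 0"
      unfolding A_def by (elim disjE) simp_all
    then show ?thesis
      unfolding lap by (simp add: telescope)
  qed
  moreover have "homogeneous_polynomial n (\<lambda>x. \<Sum>k\<le>N. zonal_coeff n k * q k x)"
    by (intro homogeneous_polynomial_sum homogeneous_polynomial_cmult q_hom) auto
  moreover have "(\<Sum>k\<le>N. zonal_coeff n k * (u \<bullet> v) ^ (n - 2 * k))
      = (\<Sum>k\<le>N. zonal_coeff n k * q k u)" if "u \<in> S2" for u
    using that by (simp add: q_def dot_square_norm)
  ultimately show ?thesis
    unfolding spherical_harmonic_def N_def by blast
qed

section \<open>Orthogonal projection onto a finite-dimensional space of functions\<close>

text \<open>
  Induction on the number of spanning functions: the members of \<open>V\<close> that have an expansion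
  without \<open>m j\<close> form a subspace \<open>V'\<close> to which the induction hypothesis applies, and \<open>V\<close> is spanned by \<open>V'\<close> and at
  most one further function, which can be made orthogonal to \<open>V'\<close> (a Gram--Schmidt step). The inner
  product is only semidefinite. If the new direction has length zero, it vanishes almost everywhere
  and is orthogonal to everything.
\<close>

lemma orthogonal_projection_exists:
  fixes V :: "('a \<Rightarrow> real) set"
  assumes "finite I"
    and "\<And>p q. p \<in> V \<Longrightarrow> q \<in> V \<Longrightarrow> integrable M (\<lambda>x. p x * q x)"
    and "\<And>q. q \<in> V \<Longrightarrow> integrable M (\<lambda>x. f x * q x)"
    and "(\<lambda>x. 0) \<in> V"
    and "\<And>p q d. p \<in> V \<Longrightarrow> q \<in> V \<Longrightarrow> (\<lambda>x. p x + d * q x) \<in> V"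
    and "\<And>p. p \<in> V \<Longrightarrow> \<exists>c. \<forall>x. p x = (\<Sum>i\<in>I. c i * m i x)"
  shows "\<exists>p\<in>V. \<forall>q\<in>V. (\<integral>x. (f x - p x) * q x \<partial>M) = 0"
  using assms
proof (induction I arbitrary: V f rule: finite_induct)
  case empty
  have "(\<integral>x. (f x - 0) * q x \<partial>M) = 0" if "q \<in> V" for q
  proof -
    have q: "q x = 0" for x
      using empty.prems(5)[OF that] by simp
    show ?thesis
      unfolding q by simp
  qed
  then show ?case
    by (intro bexI[OF _ empty.prems(3)] ballI)
next
  case (insert j I)
  note int = insert.prems(1) and int_f = insert.prems(2) and zero = insert.prems(3)
    and lincomb = insert.prems(4) and span = insert.prems(5)
  define V' where "V' = {p \<in> V. \<exists>c. \<forall>x. p x = (\<Sum>i\<in>I. c i * m i x)}"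
  have V'_sub: "p \<in> V" if "p \<in> V'" for p
    using that by (simp add: V'_def)
  have V'_lincomb: "(\<lambda>x. p x + d * q x) \<in> V'" if pq: "p \<in> V'" "q \<in> V'" for p q d
  proof -
    obtain a where "\<forall>x. p x = (\<Sum>i\<in>I. a i * m i x)"
      using pq(1) by (auto simp: V'_def)
    moreover obtain b where "\<forall>x. q x = (\<Sum>i\<in>I. b i * m i x)"
      using pq(2) by (auto simp: V'_def)
    ultimately have "\<forall>x. p x + d * q x = (\<Sum>i\<in>I. (a i + d * b i) * m i x)"
      by (simp add: sum.distrib sum_distrib_left algebra_simps)
    moreover have "(\<lambda>x. p x + d * q x) \<in> V"
      using pq by (intro lincomb V'_sub)
    ultimately show ?thesis
      unfolding V'_def by (intro CollectI conjI exI[of _ "\<lambda>i. a i + d * b i"])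
  qed
  have V'_zero: "(\<lambda>x. 0) \<in> V'"
    unfolding V'_def using zero by (auto intro: exI[of _ "\<lambda>_. 0"])
  have proj: "\<exists>p\<in>V'. \<forall>q\<in>V'. (\<integral>x. (h x - p x) * q x \<partial>M) = 0"
    if "\<And>q. q \<in> V \<Longrightarrow> integrable M (\<lambda>x. h x * q x)" for h
  proof (rule insert.IH)
    show "\<exists>c. \<forall>x. p x = (\<Sum>i\<in>I. c i * m i x)" if "p \<in> V'" for p
      using that by (simp add: V'_def)
  qed (fact V'_zero V'_lincomb int[OF V'_sub V'_sub] that[OF V'_sub])+
  obtain p where p: "p \<in> V'" "\<And>q. q \<in> V' \<Longrightarrow> (\<integral>x. (f x - p x) * q x \<partial>M) = 0"
    using proj[OF int_f] by auto
  show ?case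
  proof (cases "V \<subseteq> V'")
    case True
    then show ?thesis
      using p V'_sub by (intro bexI[of _ p] ballI) auto
  next
    case False
    then obtain v where v: "v \<in> V" "v \<notin> V'"
      by blast
    obtain p' where p': "p' \<in> V'" "\<And>q. q \<in> V' \<Longrightarrow> (\<integral>x. (v x - p' x) * q x \<partial>M) = 0"
      using proj[OF int[OF v(1)]] by auto
    define w where "w x = v x - p' x" for x
    have w: "w \<in> V"
      using lincomb[OF v(1) V'_sub[OF p'(1)], of "-1"] by (simp add: w_def[abs_def])
    have decompose: "\<exists>d q'. q' \<in> V' \<and> (\<forall>x. q x = q' x + d * w x)" if q: "q \<in> V" for q
    proof -
      obtain a where a: "\<forall>x. v x = (\<Sum>i\<in>insert j I. a i * m i x)"
        using span[OF v(1)] by blast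
      obtain b where b: "\<forall>x. q x = (\<Sum>i\<in>insert j I. b i * m i x)"
        using span[OF q] by blast
      have "a j \<noteq> 0"
      proof
        assume "a j = 0"
        then have "\<forall>x. v x = (\<Sum>i\<in>I. a i * m i x)"
          using a insert.hyps by simp
        then have "v \<in> V'"
          using v(1) by (auto simp: V'_def)
        then show False using v(2) by contradiction
      qed
      \<comment> \<open>The multiple of \<open>v\<close> that removes \<open>m j\<close> from \<open>q\<close>.\<close>
      define d where "d = b j / a j"
      have "\<forall>x. q x + (- d) * v x = (\<Sum>i\<in>I. (b i - d * a i) * m i x)"
      proof
        fix x
        have "b j = d * a j"
          using \<open>a j \<noteq> 0\<close> by (simp add: d_def)
        then show "q x + (- d) * v x = (\<Sum>i\<in>I. (b i - d * a i) * m i x)"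
          using a b insert.hyps by (simp add: algebra_simps sum_distrib_left sum_subtractf sum_negf)
      qed
      then have "(\<lambda>x. q x + (- d) * v x) \<in> V'"
        unfolding V'_def using lincomb[OF q v(1), of "- d"]
        by (intro CollectI conjI exI[of _ "\<lambda>i. b i - d * a i"])
      then have "(\<lambda>x. (q x + (- d) * v x) + d * p' x) \<in> V'"
        using p'(1) by (rule V'_lincomb)
      then show ?thesis
        by (intro exI[of _ d] exI[of _ "\<lambda>x. (q x + (- d) * v x) + d * p' x"])
          (simp add: w_def algebra_simps)
    qed
    have p_V: "p \<in> V"
      using p(1) by (rule V'_sub)
    have int_fp: "integrable M (\<lambda>x. (f x - p x) * q x)" if "q \<in> V" for q
      using int_f[OF that] int[OF p_V that] by (simp add: left_diff_distrib)
    \<comment> \<open>If \<open>w\<close> has length zero, the division by zero makes \<open>t\<close> zero, which is then a valid choice.\<close>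
    define t where "t = (\<integral>x. (f x - p x) * w x \<partial>M) / (\<integral>x. w x * w x \<partial>M)"
    have t: "(\<integral>x. (f x - p x) * w x \<partial>M) = t * (\<integral>x. w x * w x \<partial>M)"
    proof (cases "(\<integral>x. w x * w x \<partial>M) = 0")
      case True
      then have "AE x in M. w x * w x = 0"
        using int[OF w w] by (subst (asm) integral_nonneg_eq_0_iff_AE) auto
      then have "(\<integral>x. (f x - p x) * w x \<partial>M) = 0"
        by (intro integral_eq_zero_AE) auto
      then show ?thesis using True by simp
    qed (simp add: t_def)
    have orth: "(\<integral>x. (f x - (p x + t * w x)) * q x \<partial>M) = 0" if q: "q \<in> V" for q
    proof -
      obtain d q' where q': "q' \<in> V'" "\<And>x. q x = q' x + d * w x"
        using decompose[OF q] by auto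
      have q'_V: "q' \<in> V"
        using q'(1) by (rule V'_sub)
      have "(\<lambda>x. (f x - (p x + t * w x)) * q x) = (\<lambda>x. (f x - p x) * q' x - t * (w x * q' x)
          + d * ((f x - p x) * w x) - d * (t * (w x * w x)))"
        by (simp add: fun_eq_iff q'(2) algebra_simps)
      moreover have "(\<integral>x. (f x - p x) * q' x - t * (w x * q' x)
          + d * ((f x - p x) * w x) - d * (t * (w x * w x)) \<partial>M)
          = (\<integral>x. (f x - p x) * q' x \<partial>M) - t * (\<integral>x. w x * q' x \<partial>M)
          + d * (\<integral>x. (f x - p x) * w x \<partial>M) - d * (t * (\<integral>x. w x * w x \<partial>M))"
        using int_fp[OF q'_V] int_fp[OF w] int[OF w q'_V] int[OF w w] by simp
      moreover have "(\<integral>x. w x * q' x \<partial>M) = 0"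
        unfolding w_def using p'(2)[OF q'(1)] .
      ultimately show ?thesis
        using p(2)[OF q'(1)] t by simp
    qed
    have "(\<lambda>x. p x + t * w x) \<in> V"
      using lincomb[OF p_V w] .
    then show ?thesis
      using orth by (intro bexI[of _ "\<lambda>x. p x + t * w x"] ballI)
  qed
qed

section \<open>Surface measure on the sphere\<close>

lemma space_surface_measure: "space surface_measure = S2"
  by (simp add: surface_measure_def space_scale_measure space_restrict_space)

lemma sets_surface_measure [measurable_cong]: "sets surface_measure = sets (restrict_space borel S2)"
  by (simp add: surface_measure_def)

lemma sgn_in_S2: "x \<noteq> 0 \<Longrightarrow> sgn x \<in> S2" for x :: "real^3"
  by (simp add: norm_sgn)

text \<open>
  The volume of this cone is a third of the surface measure of \<open>A\<close>.
\<close>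

lemma cone_borel:
  fixes A :: "(real^3) set"
  assumes "A \<in> sets (restrict_space borel S2)"
  shows "{x \<in> cball 0 1 - {0}. sgn x \<in> A} \<in> sets borel"
proof -
  obtain T where "T \<in> sets borel" "A = S2 \<inter> T"
    using assms by (auto simp: sets_restrict_space)
  moreover from this have "{x \<in> cball 0 1 - {0}. sgn x \<in> A} = sgn -` T \<inter> (cball 0 1 - {0})"
    by (auto simp: norm_sgn)
  moreover from calculation have "sgn -` T \<inter> space borel \<in> sets borel"
    by (intro measurable_sets[OF borel_measurable_sgn])
  ultimately show ?thesis
    by (simp add: sets.Int)
qed

lemma emeasure_surface_measure:
  assumes "A \<in> sets (restrict_space borel S2)"
  shows "emeasure surface_measure A = 3 * emeasure lborel {x \<in> cball 0 1 - {0}. sgn x \<in> A}"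
proof -
  have sgn: "sgn \<in> measurable (restrict_space lborel (cball 0 1 - {0})) (restrict_space borel S2)"
    by (intro measurable_restrict_space3) (auto simp: norm_sgn)
  have "sgn -` A \<inter> space (restrict_space lborel (cball 0 1 - {0})) = {x \<in> cball 0 1 - {0}. sgn x \<in> A}"
    by (auto simp: space_restrict_space)
  moreover have "emeasure (restrict_space lborel (cball 0 1 - {0})) {x \<in> cball 0 1 - {0}. sgn x \<in> A}
      = emeasure lborel {x \<in> cball 0 1 - {0}. sgn x \<in> A}"
    by (intro emeasure_restrict_space) auto
  ultimately show ?thesis
    unfolding surface_measure_def using assms
    by (simp only: emeasure_scale_measure emeasure_distr[OF sgn])
qed

lemma finite_measure_surface_measure: "finite_measure surface_measure"
proof
  have "S2 \<in> sets (restrict_space borel S2)"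
    using sets.top[of "restrict_space borel S2"] by (simp add: space_restrict_space)
  then have "emeasure surface_measure (space surface_measure)
      = 3 * emeasure lborel {x \<in> cball 0 1 - {0}. sgn x \<in> S2}"
    unfolding space_surface_measure by (rule emeasure_surface_measure)
  also have "\<dots> < \<infinity>"
  proof -
    have "bounded {x \<in> cball 0 1 - {0::real^3}. sgn x \<in> S2}"
      by (rule bounded_subset[OF bounded_cball[of 0 1]]) auto
    from emeasure_bounded_finite[OF this] show ?thesis
      by (simp add: ennreal_mult_less_top)
  qed
  finally show "emeasure surface_measure (space surface_measure) \<noteq> \<infinity>"
    by simp
qed

interpretation surface: finite_measure surface_measure
  by (rule finite_measure_surface_measure)

lemma borel_measurable_surface:
  fixes f :: "real^3 \<Rightarrow> real"
  assumes "continuous_on S2 f"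
  shows "f \<in> borel_measurable surface_measure"
  using borel_measurable_continuous_on_restrict[OF assms]
  by (simp cong: measurable_cong_sets add: sets_surface_measure)

lemma integrable_surface:
  fixes f :: "real^3 \<Rightarrow> real"
  assumes f: "continuous_on S2 f"
  shows "integrable surface_measure f"
proof -
  have "bounded (f ` S2)"
    using f by (intro compact_imp_bounded compact_continuous_image) auto
  then obtain C where "\<forall>u\<in>S2. norm (f u) \<le> C"
    by (auto simp: bounded_iff)
  then show ?thesis
    by (intro surface.integrable_const_bound[of _ C] AE_I2 borel_measurable_surface f)
      (simp add: space_surface_measure)
qed

text \<open>Surface measure charges every nonempty relatively open set, since the cone over it is open.\<close>

lemma integral_surface_eq_0D:
  fixes f :: "real^3 \<Rightarrow> real"
  assumes f: "continuous_on S2 f" and nonneg: "\<And>u. u \<in> S2 \<Longrightarrow> 0 \<le> f u"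
    and zero: "(\<integral>u. f u \<partial>surface_measure) = 0" and v: "v \<in> S2"
  shows "f v = 0"
proof (rule ccontr)
  assume "f v \<noteq> 0"
  define K where "K = {x \<in> cball 0 1 - {0}. sgn x \<in> {u \<in> S2. f u \<noteq> 0}}"
  have "AE u in surface_measure. 0 \<le> f u"
    by (rule AE_I2) (simp add: space_surface_measure nonneg)
  then have AE: "AE u in surface_measure. f u = 0"
    using zero integral_nonneg_eq_0_iff_AE[OF integrable_surface[OF f]] by blast
  have "{u \<in> space surface_measure. f u \<noteq> 0} \<in> sets surface_measure"
    using borel_measurable_surface[OF f] by measurable
  then have meas: "{u \<in> S2. f u \<noteq> 0} \<in> sets (restrict_space borel S2)"
    by (simp only: space_surface_measure sets_surface_measure)
  have "emeasure surface_measure {u \<in> space surface_measure. f u \<noteq> 0} = 0"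
    using AE by (intro emeasure_eq_0_AE) simp
  then have null: "emeasure lborel K = 0"
    using emeasure_surface_measure[OF meas] unfolding K_def space_surface_measure by simp
  have K: "K \<in> sets lborel"
    unfolding K_def sets_lborel using meas by (rule cone_borel)
  define W where "W = {x \<in> ball 0 1 - {0}. f (sgn x) \<noteq> 0}"
  have "continuous_on (ball 0 1 - {0::real^3}) (\<lambda>x. f (sgn x))"
    by (intro continuous_on_compose2[OF f] continuous_on_sgn continuous_on_id)
      (auto simp: norm_sgn split: if_splits)
  then have W: "open W"
    unfolding W_def using continuous_open_preimage[of "ball 0 1 - {0::real^3}" "\<lambda>x. f (sgn x)" "- {0}"]
    by (simp add: open_delete vimage_def Int_def conj_assoc open_Compl)
  have "sgn ((1/2) *\<^sub>R v) = v"
    using v by (simp add: sgn_div_norm)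
  then have "(1/2) *\<^sub>R v \<in> W"
    using v \<open>f v \<noteq> 0\<close> by (auto simp: W_def)
  then have "\<not> negligible W"
    using open_not_negligible[OF W] by blast
  moreover have "negligible W"
  proof -
    have "W \<subseteq> K"
      using sgn_in_S2 by (auto simp del: mem_sphere simp: W_def K_def)
    moreover have "K \<in> null_sets lborel"
      using null K by (rule null_setsI)
    ultimately show ?thesis
      unfolding negligible_iff_null_sets null_sets_completion_iff2 by blast
  qed
  ultimately show False by blast
qed

lemma lborel_distr_minus: "distr lborel borel uminus = (lborel :: 'a::euclidean_space measure)"
  using lborel_affine[of "-1" "0::'a"] by (simp add: density_1)

lemma measurable_surface_minus: "uminus \<in> measurable surface_measure surface_measure"
  by (simp cong: measurable_cong_sets add: sets_surface_measure)
    (intro measurable_restrict_space3, auto)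

lemma surface_measure_distr_minus: "distr surface_measure surface_measure uminus = surface_measure"
proof (rule measure_eqI)
  fix A assume "A \<in> sets (distr surface_measure surface_measure uminus)"
  then have A: "A \<in> sets (restrict_space borel S2)"
    by (simp add: sets_surface_measure)
  define C where "C B = {x \<in> cball 0 1 - {0}. sgn x \<in> B}" for B :: "(real^3) set"
  have C: "C A \<in> sets borel"
    unfolding C_def using A by (rule cone_borel)
  have "emeasure (distr surface_measure surface_measure uminus) A
      = emeasure surface_measure (uminus -` A \<inter> S2)"
    using A by (simp add: emeasure_distr[OF measurable_surface_minus] sets_surface_measure space_surface_measure)
  also have "\<dots> = 3 * emeasure lborel (C (uminus -` A \<inter> S2))"
    unfolding C_def using measurable_sets[OF measurable_surface_minus, of A] A
    by (intro emeasure_surface_measure) (simp add: sets_surface_measure space_surface_measure)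
  also have "C (uminus -` A \<inter> S2) = uminus -` C A"
    by (auto simp: C_def sgn_minus norm_sgn)
  also have "emeasure lborel (uminus -` C A) = emeasure (distr lborel borel uminus) (C A)"
    using C by (simp add: emeasure_distr)
  also have "\<dots> = emeasure lborel (C A)"
    by (simp add: lborel_distr_minus)
  also have "3 * \<dots> = emeasure surface_measure A"
    using emeasure_surface_measure[OF A] by (simp add: C_def)
  finally show "emeasure (distr surface_measure surface_measure uminus) A
      = emeasure surface_measure A" .
qed simp

lemma integral_surface_minus:
  fixes f :: "real^3 \<Rightarrow> real"
  assumes "continuous_on S2 f"
  shows "(\<integral>u. f (- u) \<partial>surface_measure) = (\<integral>u. f u \<partial>surface_measure)"
  using integral_distr[OF measurable_surface_minus borel_measurable_surface[OF assms]]
  by (simp add: surface_measure_distr_minus)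

section \<open>Functions without odd-degree content are even\<close>

lemma continuous_on_inner_power: "continuous_on A (\<lambda>u. (u \<bullet> v) ^ n)" for v :: "real^3"
  by (intro continuous_intros)

lemma smooth_on_S2_continuous:
  assumes "smooth_on_S2 g"
  shows "continuous_on S2 g"
  unfolding continuous_on_eq_continuous_within
proof
  fix p assume p: "p \<in> S2"
  then obtain U f where U: "open U" "p \<in> U" "\<forall>k. Ck_on k f U" and f: "\<forall>u\<in>U \<inter> S2. f u = g u"
    using assms unfolding smooth_on_S2_def by blast
  have "continuous_on U f"
    using U(3)[rule_format, of 0] by simp
  then have "continuous (at p within S2) f"
    using U by (simp add: continuous_on_eq_continuous_at continuous_at_imp_continuous_within)
  moreover obtain e where "e > 0" "ball p e \<subseteq> U"
    using U openE by blast
  ultimately show "continuous (at p within S2) g"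
    using f p by (intro continuous_transform_within[of p S2 f e g])
      (auto simp: subset_iff dist_commute)
qed

text \<open>
  The harmonic homogeneous polynomials of degree \<open>l\<close> lie in the span of finitely many monomials, so
  the projection onto them exists.
\<close>

lemma harmonic_component_exists:
  assumes g: "continuous_on S2 g"
  shows "\<exists>Y. harmonic_component g l Y"
proof -
  define V where "V = {p. homogeneous_polynomial l p \<and> (\<forall>x. laplacian p x = 0)}"
  define m :: "nat \<times> nat \<Rightarrow> real^3 \<Rightarrow> real"
    where "m = (\<lambda>(i, j) x. x$1 ^ i * x$2 ^ j * x$3 ^ (l - i - j))"
  have V_harmonic: "spherical_harmonic l p" if "p \<in> V" for p
    using that unfolding V_def spherical_harmonic_def by blast
  have cont: "continuous_on S2 p" if "p \<in> V" for p
    using spherical_harmonic_continuous[OF V_harmonic[OF that]] .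
  have "\<exists>p\<in>V. \<forall>q\<in>V. (\<integral>u. (g u - p u) * q u \<partial>surface_measure) = 0"
  proof (rule orthogonal_projection_exists)
    show "finite (Sigma {..l} (\<lambda>i. {..l - i}))"
      by simp
    show "integrable surface_measure (\<lambda>x. p x * q x)" if "p \<in> V" "q \<in> V" for p q
      using that by (intro integrable_surface continuous_on_mult cont)
    show "integrable surface_measure (\<lambda>x. g x * q x)" if "q \<in> V" for q
      using that by (intro integrable_surface continuous_on_mult cont g)
    show "(\<lambda>x. 0) \<in> V"
      by (simp add: V_def homogeneous_polynomial_zero laplacian_zero)
    show "(\<lambda>x. p x + d * q x) \<in> V" if "p \<in> V" "q \<in> V" for p q d
    proof -
      have "homogeneous_polynomial l p" "homogeneous_polynomial l q"
        using that by (simp_all add: V_def)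
      note hom = this
      have "laplacian (\<lambda>x. p x + d * q x) x = 0" for x
        using that by (simp add: V_def laplacian_lincomb[OF hom[THEN real_polynomial_function_homogeneous]])
      then show ?thesis
        unfolding V_def using homogeneous_polynomial_lincomb[OF hom] by blast
    qed
    show "\<exists>c. \<forall>x. p x = (\<Sum>ij\<in>Sigma {..l} (\<lambda>i. {..l - i}). c ij * m ij x)" if p: "p \<in> V" for p
    proof -
      have "homogeneous_polynomial l p"
        using p by (simp add: V_def)
      then obtain a where a:
        "p = (\<lambda>x. \<Sum>i\<le>l. \<Sum>j\<le>l - i. a i j * x$1 ^ i * x$2 ^ j * x$3 ^ (l - i - j))"
        unfolding homogeneous_polynomial_def by blast
      have "\<forall>x. p x = (\<Sum>ij\<in>Sigma {..l} (\<lambda>i. {..l - i}). (\<lambda>(i, j). a i j) ij * m ij x)"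
        by (simp add: a m_def sum.Sigma split_def mult.assoc)
      then show ?thesis
        by (intro exI[of _ "\<lambda>(i, j). a i j"])
    qed
  qed
  then obtain Y where Y: "Y \<in> V" "\<forall>q\<in>V. (\<integral>u. (g u - Y u) * q u \<partial>surface_measure) = 0"
    by (rule bexE)
  have "(\<integral>u. (g u - Y u) * Z u \<partial>surface_measure) = 0" if Z: "spherical_harmonic l Z" for Z
  proof -
    obtain q where q: "q \<in> V" "\<forall>u\<in>S2. Z u = q u"
      using Z unfolding spherical_harmonic_def V_def by blast
    have "(\<integral>u. (g u - Y u) * Z u \<partial>surface_measure) = (\<integral>u. (g u - Y u) * q u \<partial>surface_measure)"
      using q(2) by (intro Bochner_Integration.integral_cong refl) (simp add: space_surface_measure)
    then show ?thesis
      using bspec[OF Y(2) q(1)] by simp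
  qed
  then show ?thesis
    unfolding harmonic_component_def using V_harmonic[OF Y(1)] by blast
qed

lemma orthogonal_to_odd_harmonics:
  assumes g: "continuous_on S2 g" and "\<not> odd_degree_content g"
    and l: "odd l" and Z: "spherical_harmonic l Z"
  shows "(\<integral>u. g u * Z u \<partial>surface_measure) = 0"
proof -
  obtain Y where Y: "harmonic_component g l Y"
    using harmonic_component_exists[OF g] by blast
  then have "\<forall>u\<in>S2. Y u = 0"
    using assms(2) l unfolding odd_degree_content_def by blast
  then have "(\<integral>u. g u * Z u \<partial>surface_measure) = (\<integral>u. (g u - Y u) * Z u \<partial>surface_measure)"
    by (intro Bochner_Integration.integral_cong refl) (simp add: space_surface_measure)
  then show ?thesis
    using Y Z unfolding harmonic_component_def by simp
qed

text \<open>
  The zonal harmonic of odd degree \<open>n\<close> with pole \<open>v\<close> is \<open>(u \<bullet> v) ^ n\<close> plus lower odd powers of \<open>u \<bullet> v\<close>.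
\<close>

lemma orthogonal_to_odd_inner_powers:
  assumes g: "continuous_on S2 g"
    and orth: "\<And>l Z. odd l \<Longrightarrow> spherical_harmonic l Z \<Longrightarrow> (\<integral>u. g u * Z u \<partial>surface_measure) = 0"
    and v: "v \<in> S2" and n: "odd n"
  shows "(\<integral>u. g u * (u \<bullet> v) ^ n \<partial>surface_measure) = 0"
  using n
proof (induction n rule: less_induct)
  case (less n)
  define J where "J k = (\<integral>u. g u * (u \<bullet> v) ^ k \<partial>surface_measure)" for k
  have J: "J (n - 2 * k) = 0" if "k \<in> {0<..n div 2}" for k
  proof -
    have "n - 2 * k < n" "odd (n - 2 * k)"
      using that less.prems by auto
    then show ?thesis
      unfolding J_def by (rule less.IH)
  qed
  have int: "integrable surface_measure (\<lambda>u. g u * (u \<bullet> v) ^ k)" for k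
    by (intro integrable_surface continuous_on_mult g continuous_on_inner_power)
  have "0 = (\<integral>u. g u * (\<Sum>k\<le>n div 2. zonal_coeff n k * (u \<bullet> v) ^ (n - 2 * k)) \<partial>surface_measure)"
    using orth[OF less.prems spherical_harmonic_zonal[OF v]] by simp
  also have "\<dots> = (\<integral>u. (\<Sum>k\<le>n div 2. zonal_coeff n k * (g u * (u \<bullet> v) ^ (n - 2 * k))) \<partial>surface_measure)"
    by (simp add: sum_distrib_left mult.left_commute)
  also have "\<dots> = (\<Sum>k\<le>n div 2. zonal_coeff n k * J (n - 2 * k))"
    using int by (simp add: J_def)
  also have "\<dots> = zonal_coeff n 0 * J (n - 2 * 0) + (\<Sum>k\<in>{0<..n div 2}. zonal_coeff n k * J (n - 2 * k))"
    by (simp only: atMost_atLeast0 sum.head)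
  also have "\<dots> = J n"
    using J by simp
  finally show ?case
    unfolding J_def by simp
qed

text \<open>
  Uniform approximation of \<open>\<phi>\<close> by polynomials on \<open>[-1, 1]\<close>, the range of \<open>u \<bullet> v\<close> on the sphere.
\<close>

lemma orthogonal_to_ridge_functions:
  assumes h: "continuous_on S2 h" and v: "v \<in> S2"
    and orth: "\<And>n. (\<integral>u. h u * (u \<bullet> v) ^ n \<partial>surface_measure) = 0"
    and phi: "continuous_on {-1..1} \<phi>"
  shows "(\<integral>u. h u * \<phi> (u \<bullet> v) \<partial>surface_measure) = 0"
proof -
  define C where "C = (\<integral>u. \<bar>h u\<bar> \<partial>surface_measure)"
  have range: "u \<bullet> v \<in> {-1..1}" if "u \<in> S2" for u
    using Cauchy_Schwarz_ineq2[of u v] that v by auto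
  have phi_v: "continuous_on S2 (\<lambda>u. \<phi> (u \<bullet> v))"
    by (rule continuous_on_compose2[OF phi]) (use range in \<open>auto intro!: continuous_intros\<close>)
  have bound: "\<bar>\<integral>u. h u * \<phi> (u \<bullet> v) \<partial>surface_measure\<bar> \<le> e * C" if e: "e > 0" for e
  proof -
    obtain p where p: "real_polynomial_function p" "\<And>x. x \<in> {-1..1} \<Longrightarrow> \<bar>\<phi> x - p x\<bar> < e"
      using Stone_Weierstrass_real_polynomial_function[OF compact_Icc phi e] by blast
    obtain a n where a: "p = (\<lambda>x. \<Sum>i\<le>n. a i * x ^ i)"
      using p(1) real_polynomial_function_iff_sum by blast
    have int: "integrable surface_measure (\<lambda>u. h u * (u \<bullet> v) ^ k)" for k
      by (intro integrable_surface continuous_on_mult h continuous_on_inner_power)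
    have p_v: "continuous_on S2 (\<lambda>u. p (u \<bullet> v))"
      unfolding a by (intro continuous_intros)
    have "(\<integral>u. h u * p (u \<bullet> v) \<partial>surface_measure)
        = (\<integral>u. (\<Sum>i\<le>n. a i * (h u * (u \<bullet> v) ^ i)) \<partial>surface_measure)"
      by (simp add: a sum_distrib_left mult.left_commute)
    also have "\<dots> = 0"
      using int orth by simp
    finally have "(\<integral>u. h u * \<phi> (u \<bullet> v) \<partial>surface_measure)
        = (\<integral>u. h u * \<phi> (u \<bullet> v) - h u * p (u \<bullet> v) \<partial>surface_measure)"
      using integrable_surface[OF continuous_on_mult[OF h phi_v]]
        integrable_surface[OF continuous_on_mult[OF h p_v]] by simp
    also have "\<bar>\<dots>\<bar> \<le> (\<integral>u. e * \<bar>h u\<bar> \<partial>surface_measure)"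
    proof (rule integral_abs_bound_integral)
      show "\<bar>h u * \<phi> (u \<bullet> v) - h u * p (u \<bullet> v)\<bar> \<le> e * \<bar>h u\<bar>" if "u \<in> space surface_measure" for u
      proof -
        have "\<bar>h u\<bar> * \<bar>\<phi> (u \<bullet> v) - p (u \<bullet> v)\<bar> \<le> \<bar>h u\<bar> * e"
          using p(2)[OF range, of u] that
          by (intro mult_left_mono) (simp_all add: space_surface_measure)
        then show ?thesis
          by (simp add: abs_mult[symmetric] right_diff_distrib mult.commute)
      qed
    qed (intro integrable_surface continuous_intros h phi_v p_v)+
    finally show ?thesis
      by (simp add: C_def)
  qed
  have "C \<ge> 0"
    unfolding C_def by simp
  have "\<bar>\<integral>u. h u * \<phi> (u \<bullet> v) \<partial>surface_measure\<bar> \<le> 0"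
  proof (rule field_le_epsilon)
    \<comment> \<open>\<open>C\<close> may be zero; hence the denominator \<open>C + 1\<close>.\<close>
    fix e :: real assume "e > 0"
    then have "e / (C + 1) * C \<le> e"
      using \<open>C \<ge> 0\<close> by (simp add: field_simps)
    moreover have "\<bar>\<integral>u. h u * \<phi> (u \<bullet> v) \<partial>surface_measure\<bar> \<le> e / (C + 1) * C"
      using bound[of "e / (C + 1)"] \<open>e > 0\<close> \<open>C \<ge> 0\<close> by simp
    ultimately show "\<bar>\<integral>u. h u * \<phi> (u \<bullet> v) \<partial>surface_measure\<bar> \<le> 0 + e"
      by linarith
  qed
  then show ?thesis by simp
qed

text \<open>
  If \<open>h v\<close> were positive, \<open>h\<close> would be positive on a cap around \<open>v\<close>, and a bump function
  supported in this cap would have a positive integral against \<open>h\<close>, although it depends on \<open>u \<bullet> v\<close>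
  only.
\<close>

lemma nonpositive_if_orthogonal_to_inner_powers:
  assumes h: "continuous_on S2 h" and v: "v \<in> S2"
    and orth: "\<And>n. (\<integral>u. h u * (u \<bullet> v) ^ n \<partial>surface_measure) = 0"
  shows "h v \<le> 0"
proof (rule ccontr)
  assume "\<not> h v \<le> 0"
  then obtain d where d: "d > 0" "\<And>u. u \<in> S2 \<Longrightarrow> dist u v < d \<Longrightarrow> dist (h u) (h v) < h v"
    using h v unfolding continuous_on_iff by (metis not_le)
  have pos: "h u > 0" if "u \<in> S2" "dist u v < d" for u
    using d(2)[OF that] by (auto simp: dist_real_def)
  \<comment> \<open>On the sphere \<open>|u - v|^2 = 2 - 2 (u \<bullet> v)\<close>, so \<open>\<phi> (u \<bullet> v)\<close> is supported in the cap of radius \<open>d\<close>.\<close>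
  define \<phi> where "\<phi> t = max 0 (t - (1 - d\<^sup>2 / 2))" for t :: real
  have phi: "continuous_on A \<phi>" for A
    unfolding \<phi>_def by (intro continuous_intros)
  have nonneg: "0 \<le> h u * \<phi> (u \<bullet> v)" if u: "u \<in> S2" for u
  proof (cases "dist u v < d")
    case True
    then show ?thesis
      using pos[OF u] by (simp add: \<phi>_def)
  next
    case False
    then have "d\<^sup>2 \<le> (dist u v)\<^sup>2"
      using d(1) by (intro power_mono) auto
    also have "\<dots> = 2 - 2 * (u \<bullet> v)"
    proof -
      have "u \<bullet> u = 1" "v \<bullet> v = 1"
        using u v by (simp_all add: dot_square_norm)
      then show ?thesis
        by (simp add: dist_norm power2_norm_eq_inner inner_diff inner_commute)
    qed
    finally show ?thesis
      by (simp add: \<phi>_def)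
  qed
  have "continuous_on S2 (\<lambda>u. h u * \<phi> (u \<bullet> v))"
    by (intro continuous_on_mult h continuous_on_compose2[OF phi[of UNIV]] continuous_intros) auto
  then have "h v * \<phi> (v \<bullet> v) = 0"
    using nonneg orthogonal_to_ridge_functions[OF h v orth phi] v by (rule integral_surface_eq_0D)
  moreover have "\<phi> (v \<bullet> v) = d\<^sup>2 / 2"
    using v by (simp add: \<phi>_def dot_square_norm)
  ultimately show False
    using \<open>\<not> h v \<le> 0\<close> d(1) by simp
qed

text \<open>
  The difference \<open>h u = g u - g (- u)\<close> is orthogonal to the odd powers of \<open>u \<bullet> v\<close> because \<open>g\<close> is,
  and to the even powers because it is odd. Both cases are read off from the effect of the
  antipodal map on the integral of \<open>g\<close> against a power. The bound \<open>h \<le> 0\<close> holds at both \<open>v\<close> and \<open>- v\<close>,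
  where \<open>h\<close> takes opposite values.
\<close>

lemma even_if_no_odd_degree_content:
  assumes g: "continuous_on S2 g" and no: "\<not> odd_degree_content g" and v: "v \<in> S2"
  shows "g (- v) = g v"
proof -
  define h where "h u = g u - g (- u)" for u
  have g': "continuous_on S2 (\<lambda>u. g (- u))"
    by (rule continuous_on_compose2[OF g]) (auto intro: continuous_intros)
  have h: "continuous_on S2 h"
    unfolding h_def by (intro continuous_on_diff g g')
  have orth: "(\<integral>u. h u * (u \<bullet> v) ^ n \<partial>surface_measure) = 0" if v: "v \<in> S2" for v n
  proof -
    define J where "J = (\<integral>u. g u * (u \<bullet> v) ^ n \<partial>surface_measure)"
    have int: "integrable surface_measure (\<lambda>u. g u * (u \<bullet> v) ^ n)"
      "integrable surface_measure (\<lambda>u. g (- u) * (u \<bullet> v) ^ n)"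
      by (intro integrable_surface continuous_on_mult g g' continuous_on_inner_power)+
    have "J = (\<integral>u. g (- u) * (- u \<bullet> v) ^ n \<partial>surface_measure)"
      unfolding J_def
      using integral_surface_minus[OF continuous_on_mult[OF g continuous_on_inner_power[of _ v n]]]
      by simp
    also have "\<dots> = (\<integral>u. (-1) ^ n * (g (- u) * (u \<bullet> v) ^ n) \<partial>surface_measure)"
      by (simp add: power_minus[of "_ \<bullet> v"] mult_ac)
    also have "\<dots> = (-1) ^ n * (\<integral>u. g (- u) * (u \<bullet> v) ^ n \<partial>surface_measure)"
      by simp
    finally have reflect: "J = (-1) ^ n * (\<integral>u. g (- u) * (u \<bullet> v) ^ n \<partial>surface_measure)" .
    have "(\<integral>u. h u * (u \<bullet> v) ^ n \<partial>surface_measure)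
        = J - (\<integral>u. g (- u) * (u \<bullet> v) ^ n \<partial>surface_measure)"
      using int by (simp add: h_def J_def left_diff_distrib)
    also have "\<dots> = 0"
    proof (cases "even n")
      case False
      then have "J = 0"
        unfolding J_def
        by (intro orthogonal_to_odd_inner_powers[OF g _ v] orthogonal_to_odd_harmonics[OF g no])
      then show ?thesis
        using reflect by simp
    qed (use reflect in simp)
    finally show ?thesis .
  qed
  have "h v \<le> 0"
    using nonpositive_if_orthogonal_to_inner_powers[OF h v orth[OF v]] .
  moreover have "- v \<in> S2"
    using v by simp
  then have "h (- v) \<le> 0"
    using nonpositive_if_orthogonal_to_inner_powers[OF h _ orth] by blast
  ultimately show ?thesis
    by (simp add: h_def)
qed

section \<open>Equilibria of centrally symmetric bodies\<close>

text \<open>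
  The first moment equals its own negative, by the reflection invariance of Lebesgue measure. If the
  integrand is not integrable, the integral is zero by convention.
\<close>

lemma centroid_eq_0:
  assumes sym: "uminus ` B = B"
  shows "centroid B = 0"
proof -
  define f where "f x = indicator B x *\<^sub>R x" for x :: "real^3"
  have mem: "- x \<in> B \<longleftrightarrow> x \<in> B" for x
    using sym by (metis image_eqI minus_minus)
  then have odd: "f (- x) = - f x" for x
    by (simp add: f_def indicator_def)
  have "integral\<^sup>L lborel f = 0"
  proof (cases "integrable lborel f")
    case True
    have "f \<in> borel_measurable borel"
      using borel_measurable_integrable[OF True] by simp
    then have "integral\<^sup>L lborel f = (\<integral>x. f (- x) \<partial>lborel)"
      using integral_distr[of uminus lborel borel f] by (simp add: lborel_distr_minus)
    then have "integral\<^sup>L lborel f = - integral\<^sup>L lborel f"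
      by (simp add: odd)
    then show ?thesis
      by (simp add: eq_neg_iff_add_eq_0 flip: scaleR_2)
  qed (rule not_integrable_integral_eq)
  then show ?thesis
    by (simp add: centroid_def set_lebesgue_integral_def f_def[abs_def])
qed

lemma body_minus:
  assumes even: "\<And>u. u \<in> S2 \<Longrightarrow> g (- u) = g u"
  shows "uminus ` body g \<epsilon> = body g \<epsilon>"
proof -
  have minus: "- x \<in> body g \<epsilon>" if x: "x \<in> body g \<epsilon>" for x
  proof -
    obtain t u where tu: "x = t *\<^sub>R u" "u \<in> S2" "0 \<le> t" "t \<le> radial g \<epsilon> u"
      using x unfolding body_def by blast
    have "- x = t *\<^sub>R (- u)" "- u \<in> S2" "t \<le> radial g \<epsilon> (- u)"
      using tu even by (simp_all add: radial_def)
    then show ?thesis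
      using tu(3) unfolding body_def by blast
  qed
  show ?thesis
  proof
    show "body g \<epsilon> \<subseteq> uminus ` body g \<epsilon>"
      using minus by (metis image_eqI minus_minus subsetI)
  qed (use minus in blast)
qed

lemma rho_minus:
  assumes even: "\<And>u. u \<in> S2 \<Longrightarrow> g (- u) = g u" and u: "u \<in> S2"
  shows "rho g \<epsilon> (- u) = rho g \<epsilon> u"
proof -
  have "centroid (body g \<epsilon>) = 0"
    by (intro centroid_eq_0 body_minus even)
  then show ?thesis
    using even[OF u] by (simp add: rho_def radial_def)
qed

text \<open>
  The chain rule for the antipodal map, which sends the tangent plane at \<open>u\<close> to the one at \<open>- u\<close>. The
  derivative is one within the sphere, as \<open>f\<close> is even there only.
\<close>

lemma critical_point_S2_minus:
  assumes even: "\<And>u. u \<in> S2 \<Longrightarrow> f (- u) = f u" and "critical_point_S2 f u"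
  shows "critical_point_S2 f (- u)"
proof -
  obtain D where u: "u \<in> S2" and D: "(f has_derivative D) (at u within S2)"
    and tangent: "\<And>v. u \<bullet> v = 0 \<Longrightarrow> D v = 0"
    using assms(2) unfolding critical_point_S2_def by blast
  have "uminus ` S2 = S2"
    by (auto simp: image_iff intro!: bexI[of _ "- _"])
  then have "((f \<circ> uminus) has_derivative (D \<circ> uminus)) (at (- u) within S2)"
    using D by (intro diff_chain_within derivative_intros) simp
  then have "(f has_derivative (D \<circ> uminus)) (at (- u) within S2)"
    using u even by (intro has_derivative_transform[of "- u" S2 f "f \<circ> uminus"]) simp_all
  moreover have "(D \<circ> uminus) v = 0" if "- u \<bullet> v = 0" for v
    using tangent[of "- v"] that by simp
  ultimately show ?thesis
    unfolding critical_point_S2_def using u by (intro conjI exI[of _ "D \<circ> uminus"]) auto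
qed

lemma eventually_at_S2_minus:
  assumes "\<forall>\<^sub>F v in at u within S2. P v"
  shows "\<forall>\<^sub>F v in at (- u) within S2. P (- v)"
proof -
  obtain d where d: "d > 0" "\<And>v. v \<in> S2 \<Longrightarrow> v \<noteq> u \<Longrightarrow> dist v u < d \<Longrightarrow> P v"
    using assms unfolding eventually_at by blast
  have "P (- v)" if "v \<in> S2" "v \<noteq> - u" "dist v (- u) < d" for v
  proof (rule d(2))
    show "- v \<in> S2" "- v \<noteq> u"
      using that by auto
    have "dist (- v) u = dist v (- u)"
      by (metis dist_minus minus_minus)
    then show "dist (- v) u < d"
      using that by simp
  qed
  then show ?thesis
    unfolding eventually_at using d(1) by blast
qed

lemma local_min_S2_minus:
  assumes even: "\<And>u. u \<in> S2 \<Longrightarrow> f (- u) = f u" and "local_min_S2 f u"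
  shows "local_min_S2 f (- u)"
proof -
  have u: "u \<in> S2" and "\<forall>\<^sub>F v in at u within S2. f u \<le> f v"
    using assms(2) unfolding local_min_S2_def by blast+
  then have "\<forall>\<^sub>F v in at (- u) within S2. f u \<le> f (- v)"
    by (intro eventually_at_S2_minus)
  moreover have "\<forall>\<^sub>F v in at (- u) within S2. v \<in> S2"
    by (auto simp: eventually_at_filter)
  ultimately have "\<forall>\<^sub>F v in at (- u) within S2. f (- u) \<le> f v"
    by eventually_elim (use even u in simp)
  then show ?thesis
    using u unfolding local_min_S2_def by simp
qed

lemma local_max_S2_minus:
  assumes even: "\<And>u. u \<in> S2 \<Longrightarrow> f (- u) = f u" and "local_max_S2 f u"
  shows "local_max_S2 f (- u)"
  using local_min_S2_minus[of "\<lambda>u. - f u" u] assms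
  unfolding local_min_S2_def local_max_S2_def by simp

lemma even_card_antipodal_pairs:
  assumes "finite A" "antipodal_pairs A"
  shows "even (card A)"
  using assms
proof (induction A rule: finite_psubset_induct)
  case (psubset A)
  show ?case
  proof (cases "A = {}")
    case False
    then obtain u where u: "u \<in> A" "- u \<in> A" "- u \<noteq> u"
      using psubset.prems unfolding antipodal_pairs_def by blast
    define B where "B = A - {u, - u}"
    have "antipodal_pairs B"
      using psubset.prems unfolding antipodal_pairs_def B_def by (auto simp: minus_equation_iff[of _ u])
    moreover have "B \<subset> A"
      using u by (auto simp: B_def)
    ultimately have "even (card B)"
      by (rule psubset.IH[rotated])
    moreover have "card A = Suc (Suc (card B))"
    proof -
      have "A = insert u (insert (- u) B)" "finite B" "- u \<notin> B" "u \<notin> insert (- u) B"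
        using psubset.hyps u by (auto simp: B_def)
      then show ?thesis
        by (metis card_insert_disjoint finite_insert)
    qed
    ultimately show ?thesis by simp
  qed simp
qed

lemma antipodal_pairs_equilibria:
  assumes even: "\<And>u. u \<in> S2 \<Longrightarrow> g (- u) = g u"
  shows "antipodal_pairs (equilibria g \<epsilon>)" (is ?equilibria)
    and "antipodal_pairs (stable_equilibria g \<epsilon>)" (is ?stable)
    and "antipodal_pairs (unstable_equilibria g \<epsilon>)" (is ?unstable)
    and "antipodal_pairs (saddle_equilibria g \<epsilon>)" (is ?saddle)
proof -
  note rho = rho_minus[of g _ \<epsilon>, OF even]
  have ne: "- u \<noteq> u" if "u \<in> equilibria g \<epsilon>" for u
  proof -
    have "u \<in> S2"
      using that by (simp add: equilibria_def critical_point_S2_def)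
    then have "u \<noteq> 0"
      by auto
    then show ?thesis
      by (metis neg_eq_iff_add_eq_0 scaleR_2 scaleR_eq_0_iff zero_neq_numeral)
  qed
  have crit: "- u \<in> equilibria g \<epsilon>" if "u \<in> equilibria g \<epsilon>" for u
    using that critical_point_S2_minus[of "rho g \<epsilon>", OF rho] unfolding equilibria_def by blast
  have stable: "- u \<in> stable_equilibria g \<epsilon>" if "u \<in> stable_equilibria g \<epsilon>" for u
    using that crit local_min_S2_minus[of "rho g \<epsilon>", OF rho] unfolding stable_equilibria_def by blast
  have unstable: "- u \<in> unstable_equilibria g \<epsilon>" if "u \<in> unstable_equilibria g \<epsilon>" for u
    using that crit local_max_S2_minus[of "rho g \<epsilon>", OF rho] unfolding unstable_equilibria_def by blast
  show ?equilibria
    using crit ne unfolding antipodal_pairs_def by blast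
  show ?stable
    using stable ne unfolding antipodal_pairs_def stable_equilibria_def by blast
  show ?unstable
    using unstable ne unfolding antipodal_pairs_def unstable_equilibria_def by blast
  show ?saddle
    using crit ne stable unstable unfolding antipodal_pairs_def saddle_equilibria_def
    by (metis DiffD1 DiffD2 DiffI minus_minus)
qed

lemma not_mono_monostatic_if_even:
  assumes "\<And>u. u \<in> S2 \<Longrightarrow> g (- u) = g u"
  shows "\<not> mono_monostatic g \<epsilon>"
proof
  assume "mono_monostatic g \<epsilon>"
  then have "card (stable_equilibria g \<epsilon>) = 1"
    by (simp add: mono_monostatic_def)
  moreover from this have "finite (stable_equilibria g \<epsilon>)"
    by (metis card.infinite zero_neq_one)
  ultimately show False
    using even_card_antipodal_pairs antipodal_pairs_equilibria(2)[of g, OF assms] by fastforce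
qed

lemma sum_of_even_harmonics_minus:
  assumes "sum_of_even_harmonics g" "u \<in> S2"
  shows "g (- u) = g u"
proof -
  obtain d Y where dY: "\<And>k::nat. even (d k)" "\<And>k. spherical_harmonic (d k) (Y k)"
    and sums: "\<And>u. u \<in> S2 \<Longrightarrow> (\<lambda>k. Y k u) sums g u"
    using assms(1) unfolding sum_of_even_harmonics_def by blast
  have "(\<lambda>k. Y k (- u)) = (\<lambda>k. Y k u)"
    using spherical_harmonic_minus[OF dY(2) assms(2)] dY(1) by (simp add: fun_eq_iff)
  moreover have "(\<lambda>k. Y k (- u)) sums g (- u)"
    using assms(2) by (intro sums) simp
  ultimately show ?thesis
    using sums[OF assms(2)] sums_unique2 by metis
qed

theorem corollary3:
  fixes g :: "real^3 \<Rightarrow> real"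
  assumes smooth: "smooth_on_S2 g"
  shows
    "(sum_of_even_harmonics g \<longrightarrow>
       (\<forall>u\<in>S2. g (- u) = g u) \<and>
       (\<forall>\<epsilon>. admissible g \<epsilon> \<longrightarrow>
          uminus ` body g \<epsilon> = body g \<epsilon> \<and>
          antipodal_pairs (equilibria g \<epsilon>) \<and>
          antipodal_pairs (stable_equilibria g \<epsilon>) \<and>
          antipodal_pairs (unstable_equilibria g \<epsilon>) \<and>
          antipodal_pairs (saddle_equilibria g \<epsilon>) \<and>
          (finite (stable_equilibria g \<epsilon>) \<longrightarrow> even (card (stable_equilibria g \<epsilon>))) \<and>
          (finite (unstable_equilibria g \<epsilon>) \<longrightarrow> even (card (unstable_equilibria g \<epsilon>))) \<and>
          \<not> mono_monostatic g \<epsilon>)) \<and>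
     (\<forall>\<epsilon>. admissible g \<epsilon> \<and> mono_monostatic g \<epsilon> \<longrightarrow> odd_degree_content g)"
proof (intro conjI impI allI ballI)
  assume g: "sum_of_even_harmonics g"
  note even = sum_of_even_harmonics_minus[OF g]
  show "g (- u) = g u" if "u \<in> S2" for u
    using that by (rule even)
  fix \<epsilon>
  show "uminus ` body g \<epsilon> = body g \<epsilon>"
    by (rule body_minus[of g, OF even])
  show "antipodal_pairs (equilibria g \<epsilon>)" "antipodal_pairs (stable_equilibria g \<epsilon>)"
    "antipodal_pairs (unstable_equilibria g \<epsilon>)" "antipodal_pairs (saddle_equilibria g \<epsilon>)"
    by (rule antipodal_pairs_equilibria[of g, OF even]; assumption)+
  show "even (card (stable_equilibria g \<epsilon>))" if "finite (stable_equilibria g \<epsilon>)"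
    using that antipodal_pairs_equilibria(2)[of g, OF even] by (rule even_card_antipodal_pairs)
  show "even (card (unstable_equilibria g \<epsilon>))" if "finite (unstable_equilibria g \<epsilon>)"
    using that antipodal_pairs_equilibria(3)[of g, OF even] by (rule even_card_antipodal_pairs)
  show "\<not> mono_monostatic g \<epsilon>"
    by (rule not_mono_monostatic_if_even[of g, OF even])
next
  fix \<epsilon>
  assume mono: "admissible g \<epsilon> \<and> mono_monostatic g \<epsilon>"
  show "odd_degree_content g"
  proof (rule ccontr)
    assume "\<not> odd_degree_content g"
    then have "g (- u) = g u" if "u \<in> S2" for u
      using even_if_no_odd_degree_content[OF smooth_on_S2_continuous[OF smooth]] that by blast
    then show False
      using mono not_mono_monostatic_if_even by blast
  qed
qed

end
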